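(* Let $S$ be a discrete semigroup, let $T$ be a closed subsemigroup of $\beta S$, let $\mathcal{F}$ be a filter on $S$ such that $\overline{\mathcal{F}}=T$, and let $A\subseteq S$. Consider the following statements. (a) $A$ is $\mathcal{F}$-central. (b) There is an $FS$-tree $\mathcal{T}$ in $A$ such that $\{B_f: f\in\mathcal{T}\}$ is collectionwise piecewise $\mathcal{F}$-syndetic. (c) There is a $\ast$-tree $\mathcal{T}$ in $A$ such that $\{B_f: f\in\mathcal{T}\}$ is collectionwise piecewise $\mathcal{F}$-syndetic. (d) There is a downward directed family $\langle C_F\rangle_{F\in I}$ of subsets of $A$ such that (i) for all $F\in I$ and all $x\in C_F$ there is some $G\in I$ with $C_G\subseteq x^{-1}C_F$, and (ii) $\{C_F: F\in I\}$ is collectionwise piecewise $\mathcal{F}$-syndetic. (e) There is a decreasing sequence $\langle C_n\rangle_{n=1}^{\infty}$ of subsets of $A$ such that (i) for all $n\in\mathbb{N}$ and all $x\in C_n$ there is some $m\in\mathbb{N}$ with $C_m\subseteq x^{-1}C_n$, and (ii) $\{C_n: n\in\mathbb{N}\}$ is collectionwise piecewise $\mathcal{F}$-syndetic. Then (a), (b), (c) and (d) are equivalent and are implied by (e). If $S$ is countable, all five statements are equivalent.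
   Context: $\beta S$ is the space of ultrafilters on $S$. For $x\in S$, $A,G\subseteq S$ put $x^{-1}A=\{y\in S: xy\in A\}$ and $G^{-1}A=\bigcup_{x\in G}x^{-1}A$. The operation on $\beta S$: $A\in p\cdot q$ iff $\{x\in S: x^{-1}A\in q\}\in p$. $\overline{\mathcal{F}}=\{p\in\beta S:\mathcal{F}\subseteq p\}$. A closed subsemigroup is nonempty; $K(T)$ is the smallest two-sided ideal of the compact right topological semigroup $T$. $\mathcal{P}_f(Y)$ is the set of finite nonempty subsets of $Y$. $A\subseteq S$ is $\mathcal{F}$-central if there is an idempotent $p\in K(\overline{\mathcal{F}})$ with $A\in p$. A family $\mathcal{A}$ of subsets of $S$ is collectionwise piecewise $\mathcal{F}$-syndetic if for every $V\in\mathcal{F}$ there exist functions $G_V:\mathcal{P}_f(\mathcal{A})\to\mathcal{P}_f(V)$ and $\delta_V:\mathcal{P}_f(\mathcal{A})\to\mathcal{F}$ such that the family $\{y^{-1}(G_V(\mathcal{B}))^{-1}(\bigcap\mathcal{B})\cap V: V\in\mathcal{F},\ y\in\delta_V(\mathcal{B}),\ \mathcal{B}\in\mathcal{P}_f(\mathcal{A})\}$ has the finite intersection property. Let $\omega=\{0,1,2,\dots\}$, each $n\in\omega$ being identified with $\{0,\dots,n-1\}$. $\mathcal{T}$ is a tree in $A$ if $\mathcal{T}$ is a nonempty set of functions such that for each $f\in\mathcal{T}$, $\mathrm{domain}(f)\in\omega$, $\mathrm{range}(f)\subseteq A$, and if $\mathrm{domain}(f)=n>0$ then $f|_{n-1}\in\mathcal{T}$.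 If $f$ is a function with $\mathrm{domain}(f)=n\in\omega$, then $f\frown x=f\cup\{(n,x)\}$. For a tree $\mathcal{T}$ and $f\in\mathcal{T}$, $B_f=B_f(\mathcal{T})=\{x: f\frown x\in\mathcal{T}\}$. $\mathcal{T}$ is a $\ast$-tree in $A$ if it is a tree in $A$ and for all $f\in\mathcal{T}$ and all $x\in B_f$, $B_{f\frown x}\subseteq x^{-1}B_f$. $\mathcal{T}$ is an $FS$-tree in $A$ if it is a tree in $A$ and for all $f\in\mathcal{T}$, $B_f=\{\prod_{t\in F}g(t): g\in\mathcal{T},\ f\subseteq g,\ \emptyset\neq F\subseteq\mathrm{domain}(g)\setminus\mathrm{domain}(f)\}$, with products taken in increasing order of indices. A family $\langle C_F\rangle_{F\in I}$ (with $I\ne\emptyset$) is downward directed if for all $F,G\in I$ there is $H\in I$ with $C_H\subseteq C_F\cap C_G$. *)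

theory Defs
  imports "HOL-Analysis.Analysis" "HOL-Library.Sublist"
begin

text \<open>The discrete semigroup \<open>S\<close> is the universe of a type of class \<open>semigroup_mult\<close>.
  Filters on \<open>S\<close> are elements of the library type of filters, which includes the improper
  filter \<open>bot\<close>.\<close>

definition members :: "'a filter \<Rightarrow> 'a set set" where
  "members F = {A. eventually (\<lambda>x. x \<in> A) F}"

definition ultrafilter :: "'a filter \<Rightarrow> bool" where
  "ultrafilter p \<longleftrightarrow> p \<noteq> bot \<and> (\<forall>A. A \<in> members p \<or> - A \<in> members p)"

definition beta :: "'a filter set" where
  "beta = {p. ultrafilter p}"

definition beta_topology :: "'a filter topology" where
  "beta_topology = topology_generated_by {{p \<in> beta. A \<in> members p} | A. True}"

text \<open>The order on filters is reversed: \<open>p \<le> F\<close> says that every member of \<open>F\<close> is a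
  member of \<open>p\<close>.\<close>

definition filter_closure :: "'a filter \<Rightarrow> 'a filter set" where
  "filter_closure F = {p \<in> beta. p \<le> F}"

definition left_quot :: "'a::semigroup_mult \<Rightarrow> 'a set \<Rightarrow> 'a set" where
  "left_quot x A = {y. x * y \<in> A}"

definition left_quot_set :: "'a::semigroup_mult set \<Rightarrow> 'a set \<Rightarrow> 'a set" where
  "left_quot_set G A = (\<Union>x\<in>G. left_quot x A)"

definition beta_mult :: "'a::semigroup_mult filter \<Rightarrow> 'a filter \<Rightarrow> 'a filter" where
  "beta_mult p q = Abs_filter (\<lambda>P. eventually (\<lambda>x. eventually (\<lambda>y. P (x * y)) q) p)"

lemma eventually_beta_mult:
  fixes p q :: "'a::semigroup_mult filter"
  shows "eventually P (beta_mult p q) \<longleftrightarrow> eventually (\<lambda>x. eventually (\<lambda>y. P (x * y)) q) p"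
  unfolding beta_mult_def
proof (rule eventually_Abs_filter, unfold_locales)
  fix P Q :: "'a \<Rightarrow> bool"
  assume "\<forall>x. P x \<longrightarrow> Q x" and "\<forall>\<^sub>F x in p. \<forall>\<^sub>F y in q. P (x * y)"
  then show "\<forall>\<^sub>F x in p. \<forall>\<^sub>F y in q. Q (x * y)"
    by (elim eventually_mono) auto
qed (auto elim: eventually_elim2)

lemma members_beta_mult:
  "A \<in> members (beta_mult p q) \<longleftrightarrow> {x. left_quot x A \<in> members q} \<in> members p"
  by (simp add: members_def left_quot_def eventually_beta_mult)

definition closed_subsemigroup :: "'a::semigroup_mult filter set \<Rightarrow> bool" where
  "closed_subsemigroup T \<longleftrightarrow>
     T \<noteq> {} \<and> closedin beta_topology T \<and> (\<forall>p\<in>T. \<forall>q\<in>T. beta_mult p q \<in> T)"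

definition two_sided_ideal :: "'a::semigroup_mult filter set \<Rightarrow> 'a filter set \<Rightarrow> bool" where
  "two_sided_ideal T I \<longleftrightarrow>
     I \<noteq> {} \<and> I \<subseteq> T \<and> (\<forall>p\<in>T. \<forall>q\<in>I. beta_mult p q \<in> I \<and> beta_mult q p \<in> I)"

definition smallest_ideal :: "'a::semigroup_mult filter set \<Rightarrow> 'a filter set" where
  "smallest_ideal T = (LEAST I. two_sided_ideal T I)"

definition filter_central :: "'a::semigroup_mult filter \<Rightarrow> 'a set \<Rightarrow> bool" where
  "filter_central F A \<longleftrightarrow>
     (\<exists>p \<in> smallest_ideal (filter_closure F). beta_mult p p = p \<and> A \<in> members p)"

definition Pf :: "'b set \<Rightarrow> 'b set set" where
  "Pf Y = {X. X \<subseteq> Y \<and> finite X \<and> X \<noteq> {}}"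

definition finite_intersection_property :: "'b set set \<Rightarrow> bool" where
  "finite_intersection_property \<C> \<longleftrightarrow> (\<forall>\<D> \<in> Pf \<C>. \<Inter>\<D> \<noteq> {})"

text \<open>The functions \<open>G\<^sub>V\<close> and \<open>\<delta>\<^sub>V\<close> are chosen simultaneously for all members \<open>V\<close> of
  the filter, since the finite intersection property concerns one family ranging over
  all \<open>V\<close>.\<close>

definition collectionwise_pws :: "'a::semigroup_mult filter \<Rightarrow> 'a set set \<Rightarrow> bool" where
  "collectionwise_pws F \<A> \<longleftrightarrow>
     (\<exists>(G :: 'a set \<Rightarrow> 'a set set \<Rightarrow> 'a set) (\<delta> :: 'a set \<Rightarrow> 'a set set \<Rightarrow> 'a set).
        (\<forall>V \<in> members F. G V \<in> Pf \<A> \<rightarrow> Pf V \<and> \<delta> V \<in> Pf \<A> \<rightarrow> members F) \<and>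
        finite_intersection_property
          {left_quot y (left_quot_set (G V \<B>) (\<Inter>\<B>)) \<inter> V | V y \<B>.
             V \<in> members F \<and> \<B> \<in> Pf \<A> \<and> y \<in> \<delta> V \<B>})"

text \<open>A function with domain \<open>n = {0, \<dots>, n - 1}\<close> is a list of length \<open>n\<close>; restriction to
  \<open>n - 1\<close> is \<open>butlast\<close>, \<open>f \<frown> x\<close> is \<open>f @ [x]\<close>, and inclusion of functions is the prefix
  order.\<close>

definition tree_in :: "'a set \<Rightarrow> 'a list set \<Rightarrow> bool" where
  "tree_in A \<T> \<longleftrightarrow>
     \<T> \<noteq> {} \<and> (\<forall>f\<in>\<T>. set f \<subseteq> A \<and> (length f > 0 \<longrightarrow> butlast f \<in> \<T>))"

definition branch :: "'a list set \<Rightarrow> 'a list \<Rightarrow> 'a set" where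
  "branch \<T> f = {x. f @ [x] \<in> \<T>}"

definition star_tree_in :: "'a::semigroup_mult set \<Rightarrow> 'a list set \<Rightarrow> bool" where
  "star_tree_in A \<T> \<longleftrightarrow>
     tree_in A \<T> \<and>
     (\<forall>f\<in>\<T>. \<forall>x\<in>branch \<T> f. branch \<T> (f @ [x]) \<subseteq> left_quot x (branch \<T> f))"

text \<open>There is no neutral element, so the value at the empty list is left unspecified.\<close>

fun list_product :: "'a::semigroup_mult list \<Rightarrow> 'a" where
  "list_product [x] = x"
| "list_product (x # y # zs) = x * list_product (y # zs)"

definition FS_tree_in :: "'a::semigroup_mult set \<Rightarrow> 'a list set \<Rightarrow> bool" where
  "FS_tree_in A \<T> \<longleftrightarrow>
     tree_in A \<T> \<and>
     (\<forall>f\<in>\<T>. branch \<T> f =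
        {list_product (map (\<lambda>t. g ! t) (sorted_list_of_set H)) | g H.
           g \<in> \<T> \<and> prefix f g \<and> H \<noteq> {} \<and> H \<subseteq> {..<length g} - {..<length f}})"

definition downward_directed :: "'i set \<Rightarrow> ('i \<Rightarrow> 'a set) \<Rightarrow> bool" where
  "downward_directed I C \<longleftrightarrow>
     I \<noteq> {} \<and> (\<forall>F\<in>I. \<forall>G\<in>I. \<exists>H\<in>I. C H \<subseteq> C F \<inter> C G)"

definition directed_witness ::
    "'a::semigroup_mult filter \<Rightarrow> 'a set \<Rightarrow> 'i set \<Rightarrow> ('i \<Rightarrow> 'a set) \<Rightarrow> bool" where
  "directed_witness \<F> A I C \<longleftrightarrow>
     (\<forall>F\<in>I. C F \<subseteq> A) \<and> downward_directed I C \<and>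
     (\<forall>F\<in>I. \<forall>x\<in>C F. \<exists>G\<in>I. C G \<subseteq> left_quot x (C F)) \<and>
     collectionwise_pws \<F> (C ` I)"

text \<open>HOL cannot quantify existentially over the type of indices. By the following lemma,
  nothing is lost by taking subsets of the semigroup as indices.\<close>

lemma directed_witness_reindex:
  fixes I :: "'i set" and C :: "'i \<Rightarrow> 'a::semigroup_mult set"
  assumes "directed_witness \<F> A I C"
  shows "\<exists>(J :: 'a set set) (D :: 'a set \<Rightarrow> 'a set). directed_witness \<F> A J D"
proof -
  have "directed_witness \<F> A (C ` I) (\<lambda>X. X)"
    using assms unfolding directed_witness_def downward_directed_def by simp
  then show ?thesis by blast
qed

definition sequence_witness ::
    "'a::semigroup_mult filter \<Rightarrow> 'a set \<Rightarrow> (nat \<Rightarrow> 'a set) \<Rightarrow> bool" where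
  "sequence_witness \<F> A C \<longleftrightarrow>
     (\<forall>n\<ge>1. C n \<subseteq> A) \<and> antimono_on {1..} C \<and>
     (\<forall>n\<ge>1. \<forall>x\<in>C n. \<exists>m\<ge>1. C m \<subseteq> left_quot x (C n)) \<and>
     collectionwise_pws \<F> (C ` {1..})"

end

(* The closed subsets of beta S are exactly the closures of filters, so compactness arguments
   become statements about filters: a decreasing chain of nonempty closed sets corresponds to a
   chain of proper filters, whose infimum is proper.

   The smallest ideal K of T consists of the q in T with q in T (u q) for all u in T. A nonempty
   family is collectionwise piecewise syndetic iff it is contained in some p in K. If p is in K,
   compactness of the minimal left ideal T p yields G, and delta (B) collects the y for which
   the translate by y lies in p. Conversely, an ultrafilter q on the family with the finite
   intersection property gives u = k q in K (any k in K), and some w u with w in T contains the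
   whole family.

   (a) -> (b): for an idempotent p in K containing A, the finite sequences all of whose ordered
   products lie in A* form an FS-tree whose branches are in p. (b) -> (c) -> (d) is bookkeeping.
   (d) -> (a): the ultrafilters of T p containing all C_F form a closed subsemigroup of K,
   so it contains an idempotent. *)
theory Submission
  imports Defs
begin

section \<open>Ultrafilters below a filter\<close>

text \<open>Zorn's lemma for the reversed order, applied to the elements of \<open>P\<close> below
  \<open>G\<close>. The empty chain is bounded by \<open>G\<close> itself, so \<open>chain\<close>
  speaks of nonempty chains only.\<close>

lemma minimal_element_exists:
  fixes P :: "'b::complete_lattice set"
  assumes "G \<in> P"
    and chain: "\<And>C. C \<noteq> {} \<Longrightarrow> C \<subseteq> P \<Longrightarrow> (\<And>x y. x \<in> C \<Longrightarrow> y \<in> C \<Longrightarrow> x \<le> y \<or> y \<le> x) \<Longrightarrow> Inf C \<in> P"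
  obtains M where "M \<in> P" "M \<le> G" "\<And>N. N \<in> P \<Longrightarrow> N \<le> M \<Longrightarrow> N = M"
proof -
  let ?Q = "{N \<in> P. N \<le> G}"
  have "\<exists>m\<in>?Q. \<forall>a\<in>?Q. a \<le> m \<longrightarrow> a = m"
  proof (rule predicate_Zorn[where P = "\<lambda>x y. y \<le> x"])
    show "partial_order_on ?Q (relation_of (\<lambda>x y. y \<le> x) ?Q)"
      by (rule partial_order_on_relation_ofI) auto
    fix C assume "C \<in> Chains (relation_of (\<lambda>x y. y \<le> x) ?Q)"
    then have C: "C \<subseteq> ?Q" "\<And>x y. x \<in> C \<Longrightarrow> y \<in> C \<Longrightarrow> x \<le> y \<or> y \<le> x"
      unfolding Chains_def relation_of_def by auto
    show "\<exists>u\<in>?Q. \<forall>a\<in>C. u \<le> a"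
    proof (cases "C = {}")
      case True
      then show ?thesis using assms(1) by auto
    next
      case False
      then have "Inf C \<in> P" using C by (intro chain) auto
      moreover have "Inf C \<le> G" using False C(1) by (auto intro: Inf_lower2)
      ultimately show ?thesis by (auto intro: Inf_lower)
    qed
  qed
  then obtain m where "m \<in> P" "m \<le> G" "\<And>a. a \<in> P \<Longrightarrow> a \<le> G \<Longrightarrow> a \<le> m \<Longrightarrow> a = m"
    by auto
  then show ?thesis using that order_trans by metis
qed

text \<open>A chain of filters is a base of its infimum: a member of the infimum is a member of some
  filter in the chain, and the empty set is a member of none. This is compactness for nested closed
  sets.\<close>

lemma Inf_chain_neq_bot:
  fixes C :: "'a filter set"
  assumes "C \<noteq> {}" "\<And>x y. x \<in> C \<Longrightarrow> y \<in> C \<Longrightarrow> x \<le> y \<or> y \<le> x" "\<And>x. x \<in> C \<Longrightarrow> x \<noteq> bot"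
  shows "Inf C \<noteq> bot"
proof
  assume "Inf C = bot"
  then have "eventually (\<lambda>_. False) (Inf C)" by simp
  moreover have "eventually (\<lambda>_. False) (Inf C) \<longleftrightarrow> (\<exists>b\<in>C. eventually (\<lambda>_. False) b)"
  proof (rule eventually_Inf_base[OF assms(1)])
    fix F G assume "F \<in> C" "G \<in> C"
    then show "\<exists>x\<in>C. x \<le> inf F G" using assms(2)[of F G] by auto
  qed
  ultimately show False using assms(3) by (auto simp: eventually_False)
qed

section \<open>Members of a filter, and closed sets as closures of filters\<close>

lemma mem_members: "A \<in> members F \<longleftrightarrow> eventually (\<lambda>x. x \<in> A) F"
  by (simp add: members_def)

lemma members_Int: "A \<inter> B \<in> members F \<longleftrightarrow> A \<in> members F \<and> B \<in> members F"
  by (simp add: mem_members eventually_conj_iff)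

lemma members_mono: "A \<in> members F \<Longrightarrow> A \<subseteq> B \<Longrightarrow> B \<in> members F"
  unfolding mem_members by (erule eventually_mono) auto

lemma members_UNIV: "UNIV \<in> members F"
  by (simp add: mem_members)

lemma members_antimono: "p \<le> F \<Longrightarrow> A \<in> members F \<Longrightarrow> A \<in> members p"
  by (simp add: mem_members le_filter_def)

lemma members_le_iff: "p \<le> F \<longleftrightarrow> members F \<subseteq> members p"
proof
  assume *: "members F \<subseteq> members p"
  show "p \<le> F"
    unfolding le_filter_def
  proof (intro allI impI)
    fix P assume "eventually P F"
    then have "{x. P x} \<in> members F" by (simp add: mem_members)
    then have "{x. P x} \<in> members p" using * by auto
    then show "eventually P p" by (simp add: mem_members)
  qed
qed (auto intro: members_antimono)

lemma members_Inter:
  assumes "finite \<B>" "\<B> \<subseteq> members F"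
  shows "\<Inter>\<B> \<in> members F"
  using assms by (induction \<B> rule: finite_induct) (auto simp: members_UNIV members_Int)

lemma members_eq_iff: "F = G \<longleftrightarrow> members F = members G"
  by (metis members_le_iff order_antisym order_refl)

lemma empty_members: "{} \<in> members F \<longleftrightarrow> F = bot"
  by (simp add: mem_members eventually_False)

lemma le_principal_members: "F \<le> principal A \<longleftrightarrow> A \<in> members F"
  by (simp add: le_principal mem_members)

text \<open>A minimal proper filter \<open>M\<close> below \<open>F\<close> is an ultrafilter: if
  \<open>A\<close> is not a member, then restricting \<open>M\<close> to \<open>- A\<close> keeps it
  proper, so by minimality \<open>- A\<close> was a member already.\<close>

lemma ultrafilter_exists:
  assumes "F \<noteq> bot"
  obtains p where "p \<in> filter_closure F"
proof -
  obtain M where M: "M \<in> {N. N \<noteq> bot}" "M \<le> F" "\<And>N. N \<in> {N. N \<noteq> bot} \<Longrightarrow> N \<le> M \<Longrightarrow> N = M"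
  proof (rule minimal_element_exists[of F "{N. N \<noteq> bot}"])
    fix C :: "'a filter set"
    assume "C \<noteq> {}" "C \<subseteq> {N. N \<noteq> bot}" "\<And>x y. x \<in> C \<Longrightarrow> y \<in> C \<Longrightarrow> x \<le> y \<or> y \<le> x"
    then show "Inf C \<in> {N. N \<noteq> bot}" using Inf_chain_neq_bot[of C] by blast
  qed (use assms in blast)+
  have "- A \<in> members M" if "A \<notin> members M" for A
  proof -
    have "inf M (principal (- A)) \<noteq> bot"
    proof
      assume "inf M (principal (- A)) = bot"
      then have "eventually (\<lambda>_. False) (inf M (principal (- A)))" by simp
      then show False using that by (simp add: eventually_inf_principal mem_members)
    qed
    then have "inf M (principal (- A)) = M" using M(3)[of "inf M (principal (- A))"] by simp
    then have "M \<le> principal (- A)" by (simp add: inf.absorb_iff1)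
    then show ?thesis by (simp add: le_principal_members)
  qed
  then have "M \<in> filter_closure F"
    using M unfolding filter_closure_def beta_def ultrafilter_def by auto
  then show ?thesis by (rule that)
qed

lemma beta_Compl: "p \<in> beta \<Longrightarrow> - A \<in> members p \<longleftrightarrow> A \<notin> members p"
  using members_Int[of A "- A" p] empty_members[of p]
  by (auto simp: beta_def ultrafilter_def)

lemma beta_neq_bot: "p \<in> beta \<Longrightarrow> p \<noteq> bot"
  by (simp add: beta_def ultrafilter_def)

lemma beta_maximal:
  assumes "p \<in> beta" "q \<in> beta" "p \<le> q"
  shows "p = q"
  using assms beta_Compl[of p] beta_Compl[of q] members_antimono[OF assms(3)]
  by (metis members_eq_iff subsetI subset_antisym)

text \<open>If \<open>A\<close> is not a member of \<open>F\<close>, then \<open>F\<close>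
  restricted to \<open>- A\<close> is proper, and an ultrafilter below it omits
  \<open>A\<close>.\<close>

lemma members_filter_closure:
  assumes "\<And>p. p \<in> filter_closure F \<Longrightarrow> A \<in> members p"
  shows "A \<in> members F"
proof (rule ccontr)
  assume "A \<notin> members F"
  then have "inf F (principal (- A)) \<noteq> bot"
    using eventually_inf_principal[of "\<lambda>_. False" F "- A"] by (auto simp: mem_members)
  then obtain p where p: "p \<in> filter_closure (inf F (principal (- A)))"
    by (rule ultrafilter_exists)
  then have "p \<in> filter_closure F" "- A \<in> members p"
    by (auto simp: filter_closure_def le_principal_members)
  moreover have "p \<in> beta" using p by (simp add: filter_closure_def)
  ultimately show False using assms beta_Compl by blast
qed

text \<open>By \<open>members_filter_closure\<close> a filter is recovered from its closure. Since
  the two orders agree, minimal closed sets of a given kind can be found as minimal filters.\<close>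

lemma filter_closure_subset_iff: "filter_closure F \<subseteq> filter_closure G \<longleftrightarrow> F \<le> G"
proof
  assume sub: "filter_closure F \<subseteq> filter_closure G"
  have "A \<in> members F" if "A \<in> members G" for A
  proof (rule members_filter_closure)
    fix p assume "p \<in> filter_closure F"
    then have "p \<le> G" using sub by (auto simp: filter_closure_def)
    then show "A \<in> members p" using that by (rule members_antimono)
  qed
  then show "F \<le> G" by (auto simp: members_le_iff)
qed (auto simp: filter_closure_def intro: order_trans)

lemma filter_closure_inf: "filter_closure (inf F G) = filter_closure F \<inter> filter_closure G"
  by (auto simp: filter_closure_def)

lemma filter_closure_Inf:
  "C \<noteq> {} \<Longrightarrow> filter_closure (Inf C) = \<Inter> (filter_closure ` C)"
  by (auto simp: filter_closure_def le_Inf_iff)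

lemma filter_closure_empty_iff: "filter_closure F = {} \<longleftrightarrow> F = bot"
  using ultrafilter_exists[of F] by (auto simp: filter_closure_def beta_neq_bot bot_unique)

section \<open>Compactness of closed sets of ultrafilters\<close>

lemma beta_Union:
  assumes "p \<in> beta" "finite X" "(\<Union>x\<in>X. D x) \<in> members p"
  obtains x where "x \<in> X" "D x \<in> members p"
proof (rule ccontr)
  assume "\<not> thesis"
  then have "(\<lambda>x. - D x) ` X \<subseteq> members p" using that assms(1) beta_Compl by fastforce
  then have "\<Inter> ((\<lambda>x. - D x) ` X) \<in> members p" using assms(2) by (intro members_Inter) auto
  then have "- (\<Union>x\<in>X. D x) \<in> members p" by (simp add: Compl_UN)
  then show False using assms beta_Compl by blast
qed

text \<open>The ultrafilters containing \<open>D x\<close> form an open set. If these sets cover the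
  closure of \<open>H\<close>, no ultrafilter lies below \<open>H\<close> together with all
  \<open>- D x\<close>, so that filter is improper, and only finitely many \<open>x\<close> enter
  into its containing the empty set.\<close>

lemma filter_closure_compact:
  assumes cover: "\<And>q. q \<in> filter_closure H \<Longrightarrow> \<exists>x\<in>V. D x \<in> members q"
  obtains X where "finite X" "X \<subseteq> V" "(\<Union>x\<in>X. D x) \<in> members H"
proof -
  let ?N = "INF x\<in>V. principal (- D x)"
  have "filter_closure (inf H ?N) = {}"
  proof (rule ccontr)
    assume "filter_closure (inf H ?N) \<noteq> {}"
    then obtain q where q: "q \<in> beta" "q \<le> H" "q \<le> ?N" by (auto simp: filter_closure_def)
    then obtain x where "x \<in> V" "D x \<in> members q"
      using cover[of q] by (auto simp: filter_closure_def)
    moreover from q(3) this have "- D x \<in> members q"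
      by (auto simp: le_INF_iff le_principal_members)
    ultimately show False using q(1) beta_Compl by blast
  qed
  then have "eventually (\<lambda>_. False) (inf H ?N)"
    by (simp add: filter_closure_empty_iff)
  then obtain P Q where PQ: "eventually P H" "eventually Q ?N" "\<And>x. P x \<Longrightarrow> Q x \<Longrightarrow> False"
    unfolding eventually_inf by auto
  from PQ(2) obtain X where X: "finite X" "X \<subseteq> V" "eventually Q (INF x\<in>X. principal (- D x))"
    unfolding eventually_INF[of _ _ V] by auto
  have "(INF x\<in>X. principal (- D x)) = principal (\<Inter>x\<in>X. - D x)"
    using X(1) by (simp add: INF_principal_finite)
  then have "\<And>x. x \<in> (\<Inter>x\<in>X. - D x) \<Longrightarrow> Q x"
    using X(3) by (simp add: eventually_principal)
  then have "eventually (\<lambda>x. x \<in> (\<Union>x\<in>X. D x)) H"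
    using PQ(3) by (intro eventually_mono[OF PQ(1)]) blast
  then show ?thesis using that X by (simp add: mem_members)
qed

section \<open>Multiplication of ultrafilters\<close>

lemma beta_mult_assoc: "beta_mult (beta_mult p q) r = beta_mult p (beta_mult q r)"
  by (simp add: filter_eq_iff eventually_beta_mult mult.assoc)

lemma beta_mult_mono: "p \<le> p' \<Longrightarrow> beta_mult p q \<le> beta_mult p' q"
  by (simp add: le_filter_def eventually_beta_mult)

lemma left_quot_Compl: "left_quot x (- A) = - left_quot x A"
  by (auto simp: left_quot_def)

lemma left_quot_left_quot: "left_quot y (left_quot x A) = left_quot (x * y) A"
  by (auto simp: left_quot_def mult.assoc)

lemma beta_mult_beta:
  assumes "p \<in> beta" "q \<in> beta"
  shows "beta_mult p q \<in> beta"
proof -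
  have Compl: "- A \<in> members (beta_mult p q) \<longleftrightarrow> A \<notin> members (beta_mult p q)" for A
    using beta_Compl[OF assms(1)]
    by (simp add: members_beta_mult left_quot_Compl beta_Compl[OF assms(2)] Collect_neg_eq)
  have "beta_mult p q \<noteq> bot"
    using Compl[of UNIV] members_UNIV by (auto simp: empty_members)
  then show ?thesis
    using Compl by (auto simp: beta_def ultrafilter_def)
qed

text \<open>The filter form of a preimage under right translation by \<open>q\<close>: an
  ultrafilter \<open>p\<close> lies below it iff all sets of \<open>\<A>\<close> belong to
  \<open>p q\<close>. Its existence as a filter expresses the continuity of right
  translations.\<close>

definition right_preimage :: "'a::semigroup_mult filter \<Rightarrow> 'a set set \<Rightarrow> 'a filter" where
  "right_preimage q \<A> = (INF A\<in>\<A>. principal {x. left_quot x A \<in> members q})"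

lemma le_right_preimage: "p \<le> right_preimage q \<A> \<longleftrightarrow> \<A> \<subseteq> members (beta_mult p q)"
  by (auto simp: right_preimage_def le_INF_iff le_principal_members members_beta_mult)

lemma filter_closure_right_preimage:
  "q \<in> beta \<Longrightarrow>
    filter_closure (right_preimage q (members G)) = {p \<in> beta. beta_mult p q \<in> filter_closure G}"
  by (auto simp: filter_closure_def le_right_preimage members_le_iff[of "beta_mult _ q"]
      beta_mult_beta)

text \<open>Multiplying a filter by \<open>q\<close> encodes the image of its closure under right
  translation. For \<open>r\<close> below \<open>beta_mult F q\<close>, an ultrafilter below both
  \<open>F\<close> and \<open>right_preimage q (members r)\<close> is a preimage of
  \<open>r\<close>; if there were none, compactness would give a finite intersection of members of
  \<open>r\<close> whose complement is in \<open>r\<close>.\<close>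

lemma filter_closure_mult:
  assumes q: "q \<in> beta"
  shows "filter_closure (beta_mult F q) = (\<lambda>p. beta_mult p q) ` filter_closure F"
proof
  show "(\<lambda>p. beta_mult p q) ` filter_closure F \<subseteq> filter_closure (beta_mult F q)"
    using q by (auto simp: filter_closure_def beta_mult_beta beta_mult_mono)
  show "filter_closure (beta_mult F q) \<subseteq> (\<lambda>p. beta_mult p q) ` filter_closure F"
  proof
    fix r assume "r \<in> filter_closure (beta_mult F q)"
    then have r: "r \<in> beta" "r \<le> beta_mult F q" by (auto simp: filter_closure_def)
    have "inf F (right_preimage q (members r)) \<noteq> bot"
    proof
      assume bot: "inf F (right_preimage q (members r)) = bot"
      have "\<exists>A\<in>members r. - {x. left_quot x A \<in> members q} \<in> members p"
        if "p \<in> filter_closure F" for p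
      proof -
        have p: "p \<in> beta" "p \<le> F" using that by (auto simp: filter_closure_def)
        have "\<not> p \<le> right_preimage q (members r)"
        proof
          assume "p \<le> right_preimage q (members r)"
          then have "p \<le> inf F (right_preimage q (members r))" using p by simp
          then have "p = bot" using bot by (simp add: bot_unique)
          then show False using p beta_neq_bot by blast
        qed
        then obtain A where "A \<in> members r" "A \<notin> members (beta_mult p q)"
          by (auto simp: le_right_preimage)
        then show ?thesis using beta_Compl[OF p(1)] by (auto simp: members_beta_mult)
      qed
      then obtain X where X: "finite X" "X \<subseteq> members r"
          "(\<Union>A\<in>X. - {x. left_quot x A \<in> members q}) \<in> members F"
        using filter_closure_compact[of F "members r" "\<lambda>A. - {x. left_quot x A \<in> members q}"]
        by metis
      have "(\<Union>A\<in>X. - {x. left_quot x A \<in> members q}) \<subseteq> {x. left_quot x (- \<Inter>X) \<in> members q}"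
      proof
        fix x assume "x \<in> (\<Union>A\<in>X. - {x. left_quot x A \<in> members q})"
        then obtain A where "A \<in> X" "left_quot x (- A) \<in> members q"
          using beta_Compl[OF q] by (auto simp: left_quot_Compl)
        then show "x \<in> {x. left_quot x (- \<Inter>X) \<in> members q}"
          by (auto simp: left_quot_def elim!: members_mono)
      qed
      then have "- \<Inter>X \<in> members (beta_mult F q)"
        using X(3) members_mono by (auto simp: members_beta_mult)
      then have "- \<Inter>X \<in> members r" using r(2) members_antimono by blast
      moreover have "\<Inter>X \<in> members r" using X members_Inter by blast
      ultimately show False using beta_Compl[OF r(1)] by blast
    qed
    then obtain p where "p \<in> filter_closure (inf F (right_preimage q (members r)))"
      by (rule ultrafilter_exists)
    then have p: "p \<in> filter_closure F" "p \<in> beta" "members r \<subseteq> members (beta_mult p q)"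
      by (auto simp: filter_closure_def le_right_preimage)
    then have "beta_mult p q = r"
      using beta_maximal beta_mult_beta q r(1) by (metis members_le_iff)
    then show "r \<in> (\<lambda>p. beta_mult p q) ` filter_closure F" using p(1) by blast
  qed
qed

section \<open>Idempotents in closed subsemigroups\<close>

definition mult_closed :: "'a::semigroup_mult filter set \<Rightarrow> bool" where
  "mult_closed M \<longleftrightarrow> (\<forall>p\<in>M. \<forall>q\<in>M. beta_mult p q \<in> M)"

text \<open>The Ellis--Numakura argument: in a minimal closed subsemigroup \<open>M\<close> both \<open>M p\<close> and
  \<open>{r \<in> M. r p = p}\<close> equal \<open>M\<close>.\<close>

lemma idempotent_exists:
  assumes "G \<noteq> bot" "mult_closed (filter_closure G)"
  obtains e where "e \<in> filter_closure G" "beta_mult e e = e"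
proof -
  let ?P = "{N. N \<noteq> bot \<and> mult_closed (filter_closure N)}"
  obtain M where M: "M \<in> ?P" "M \<le> G" "\<And>N. N \<in> ?P \<Longrightarrow> N \<le> M \<Longrightarrow> N = M"
  proof (rule minimal_element_exists[of G ?P])
    fix C :: "'a filter set"
    assume C: "C \<noteq> {}" "C \<subseteq> ?P" "\<And>x y. x \<in> C \<Longrightarrow> y \<in> C \<Longrightarrow> x \<le> y \<or> y \<le> x"
    have "Inf C \<noteq> bot" using C by (intro Inf_chain_neq_bot) auto
    moreover have "mult_closed (filter_closure (Inf C))"
      using C(2) unfolding filter_closure_Inf[OF C(1)] mult_closed_def by blast
    ultimately show "Inf C \<in> ?P" by simp
  qed (use assms in blast)+
  then have closed: "mult_closed (filter_closure M)" by blast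
  obtain p where p: "p \<in> filter_closure M" using M(1) ultrafilter_exists by blast
  then have pb: "p \<in> beta" by (simp add: filter_closure_def)
  have Mp: "filter_closure (beta_mult M p) = (\<lambda>r. beta_mult r p) ` filter_closure M"
    using pb by (rule filter_closure_mult)
  have "beta_mult M p = M"
  proof (rule M(3))
    show "beta_mult M p \<le> M"
      unfolding filter_closure_subset_iff[symmetric] Mp
      using closed p by (auto simp: mult_closed_def)
    have "filter_closure (beta_mult M p) \<noteq> {}" using Mp p by auto
    moreover have "mult_closed (filter_closure (beta_mult M p))"
      unfolding Mp using closed p by (auto simp: mult_closed_def beta_mult_assoc[symmetric])
    ultimately show "beta_mult M p \<in> ?P" by (simp add: filter_closure_empty_iff)
  qed
  then obtain r where r: "r \<in> filter_closure M" "beta_mult r p = p" using Mp p by force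
  \<comment> \<open>As an ultrafilter, \<open>p\<close> is the only point of its own closure, so
    \<open>right_preimage p (members p)\<close> has as its closure the solutions \<open>r\<close> of
    \<open>r p = p\<close>.\<close>
  let ?N = "inf M (right_preimage p (members p))"
  have N: "filter_closure ?N = {r \<in> filter_closure M. beta_mult r p = p}"
  proof -
    have "r \<le> p \<longleftrightarrow> r = p" if "r \<in> beta" for r
      using beta_maximal[OF that pb] by auto
    then show ?thesis
      using pb by (auto simp: filter_closure_inf filter_closure_right_preimage[OF pb])
        (auto simp: filter_closure_def beta_mult_beta)
  qed
  have "?N = M"
  proof (rule M(3))
    have "filter_closure ?N \<noteq> {}" unfolding N using r by blast
    moreover have "mult_closed (filter_closure ?N)"
      unfolding N using closed by (auto simp: mult_closed_def beta_mult_assoc)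
    ultimately show "?N \<in> ?P" by (simp add: filter_closure_empty_iff)
  qed simp
  then have "beta_mult p p = p" using p N by auto
  moreover have "p \<in> filter_closure G" using p M(2) filter_closure_subset_iff by blast
  ultimately show ?thesis using that by blast
qed

section \<open>The smallest ideal\<close>

text \<open>Take \<open>q\<close> in a minimal closed left ideal \<open>L\<close>. For
  \<open>u\<close> in the closure of \<open>F\<close>, the products \<open>v (u q)\<close> form a
  closed left ideal inside \<open>L\<close>; by minimality it is all of \<open>L\<close> and so
  contains \<open>q\<close>.\<close>

lemma recurrent_element_exists:
  assumes "F \<noteq> bot" "mult_closed (filter_closure F)"
  obtains q where "q \<in> filter_closure F"
    "\<And>u. u \<in> filter_closure F \<Longrightarrow> \<exists>v\<in>filter_closure F. q = beta_mult v (beta_mult u q)"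
proof -
  let ?T = "filter_closure F"
  let ?P = "{N. N \<noteq> bot \<and> N \<le> F \<and> (\<forall>p\<in>?T. \<forall>q\<in>filter_closure N. beta_mult p q \<in> filter_closure N)}"
  obtain L where L: "L \<in> ?P" "L \<le> F" "\<And>N. N \<in> ?P \<Longrightarrow> N \<le> L \<Longrightarrow> N = L"
  proof (rule minimal_element_exists[of F ?P])
    show "F \<in> ?P" using assms by (auto simp: mult_closed_def)
    fix C :: "'a filter set"
    assume C: "C \<noteq> {}" "C \<subseteq> ?P" "\<And>x y. x \<in> C \<Longrightarrow> y \<in> C \<Longrightarrow> x \<le> y \<or> y \<le> x"
    have "Inf C \<noteq> bot" using C by (intro Inf_chain_neq_bot) auto
    moreover have "Inf C \<le> F" using C(1,2) by (auto intro: Inf_lower2)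
    moreover have "\<forall>p\<in>?T. \<forall>q\<in>filter_closure (Inf C). beta_mult p q \<in> filter_closure (Inf C)"
      using C(2) unfolding filter_closure_Inf[OF C(1)] by blast
    ultimately show "Inf C \<in> ?P" by blast
  qed blast
  obtain q where q: "q \<in> filter_closure L" using L(1) ultrafilter_exists by blast
  have sub: "filter_closure L \<subseteq> ?T" using L(2) filter_closure_subset_iff by blast
  have "\<exists>v\<in>?T. q = beta_mult v (beta_mult u q)" if "u \<in> ?T" for u
  proof -
    let ?r = "beta_mult u q"
    have r: "?r \<in> filter_closure L" using L(1) that q by blast
    then have Tr: "filter_closure (beta_mult F ?r) = (\<lambda>v. beta_mult v ?r) ` ?T"
      by (intro filter_closure_mult) (simp add: filter_closure_def)
    have "beta_mult F ?r = L"
    proof (rule L(3))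
      show le: "beta_mult F ?r \<le> L"
        unfolding filter_closure_subset_iff[symmetric] Tr using L(1) r by blast
      have "filter_closure (beta_mult F ?r) \<noteq> {}" using Tr that by auto
      moreover have "\<forall>p\<in>?T. \<forall>s\<in>filter_closure (beta_mult F ?r).
          beta_mult p s \<in> filter_closure (beta_mult F ?r)"
        unfolding Tr using assms(2) by (auto simp: mult_closed_def beta_mult_assoc[symmetric])
      ultimately show "beta_mult F ?r \<in> ?P"
        using le L(2) by (simp add: filter_closure_empty_iff order_trans[of _ L])
    qed
    then show ?thesis using q Tr by auto
  qed
  then show ?thesis using q sub by (intro that[of q]) auto
qed

text \<open>For left multiplication by \<open>r\<close>, use the recurrence of \<open>q\<close> for
  \<open>u r\<close> in place of \<open>u\<close> and multiply it by \<open>r\<close> on the left.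
  For right multiplication, multiply the recurrence for \<open>u\<close> by \<open>r\<close> on the
  right.\<close>

lemma two_sided_ideal_recurrent:
  assumes "F \<noteq> bot" and T: "mult_closed (filter_closure F)"
  defines "T \<equiv> filter_closure F"
  defines "K \<equiv> {q \<in> T. \<forall>u\<in>T. \<exists>v\<in>T. q = beta_mult v (beta_mult u q)}"
  shows "two_sided_ideal T K"
proof -
  have mult: "beta_mult p q \<in> T" if "p \<in> T" "q \<in> T" for p q
    using T that by (simp add: mult_closed_def T_def)
  obtain q where "q \<in> K"
  proof (rule recurrent_element_exists[OF assms(1) T])
    fix q assume "q \<in> filter_closure F"
      "\<And>u. u \<in> filter_closure F \<Longrightarrow> \<exists>v\<in>filter_closure F. q = beta_mult v (beta_mult u q)"
    then show thesis by (intro that[of q]) (simp add: K_def T_def)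
  qed
  then have "K \<noteq> {}" by blast
  moreover have "K \<subseteq> T" by (auto simp: K_def)
  moreover have "beta_mult r q \<in> K" if "r \<in> T" "q \<in> K" for r q
  proof -
    have "\<exists>v\<in>T. beta_mult r q = beta_mult v (beta_mult u (beta_mult r q))" if u: "u \<in> T" for u
    proof -
      obtain v where v: "v \<in> T" "q = beta_mult v (beta_mult (beta_mult u r) q)"
        using \<open>q \<in> K\<close> mult[OF u \<open>r \<in> T\<close>] unfolding K_def by blast
      have "beta_mult r q = beta_mult r (beta_mult v (beta_mult (beta_mult u r) q))"
        using v(2) by simp
      then have "beta_mult r q = beta_mult (beta_mult r v) (beta_mult u (beta_mult r q))"
        by (simp only: beta_mult_assoc)
      then show ?thesis using mult[OF \<open>r \<in> T\<close> v(1)] by blast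
    qed
    then show ?thesis using that mult by (auto simp: K_def)
  qed
  moreover have "beta_mult q r \<in> K" if "r \<in> T" "q \<in> K" for r q
  proof -
    have "\<exists>v\<in>T. beta_mult q r = beta_mult v (beta_mult u (beta_mult q r))" if u: "u \<in> T" for u
    proof -
      obtain v where v: "v \<in> T" "q = beta_mult v (beta_mult u q)"
        using \<open>q \<in> K\<close> u unfolding K_def by blast
      have "beta_mult q r = beta_mult (beta_mult v (beta_mult u q)) r"
        using v(2) by simp
      then have "beta_mult q r = beta_mult v (beta_mult u (beta_mult q r))"
        by (simp only: beta_mult_assoc)
      then show ?thesis using v(1) by blast
    qed
    then show ?thesis using that mult by (auto simp: K_def)
  qed
  ultimately show ?thesis unfolding two_sided_ideal_def by blast
qed

text \<open>If \<open>i\<close> lies in an ideal \<open>I\<close>, the choice \<open>u = i\<close>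
  writes \<open>q\<close> as \<open>v (i q)\<close>, an element of \<open>I\<close>. So the
  recurrent elements lie in every two-sided ideal, and they form one themselves.\<close>

lemma smallest_ideal_eq:
  assumes "F \<noteq> bot" and "mult_closed (filter_closure F)"
  defines "T \<equiv> filter_closure F"
  shows "smallest_ideal T = {q \<in> T. \<forall>u\<in>T. \<exists>v\<in>T. q = beta_mult v (beta_mult u q)}"
  unfolding smallest_ideal_def
proof (rule Least_equality)
  show "two_sided_ideal T {q \<in> T. \<forall>u\<in>T. \<exists>v\<in>T. q = beta_mult v (beta_mult u q)}"
    unfolding T_def using assms(1,2) by (rule two_sided_ideal_recurrent)
  fix I assume I: "two_sided_ideal T I"
  then obtain i where i: "i \<in> I" "i \<in> T" unfolding two_sided_ideal_def by blast
  show "{q \<in> T. \<forall>u\<in>T. \<exists>v\<in>T. q = beta_mult v (beta_mult u q)} \<subseteq> I"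
  proof
    fix q assume "q \<in> {q \<in> T. \<forall>u\<in>T. \<exists>v\<in>T. q = beta_mult v (beta_mult u q)}"
    then obtain v where "q \<in> T" "v \<in> T" "q = beta_mult v (beta_mult i q)" using i by blast
    then show "q \<in> I" using I i unfolding two_sided_ideal_def by metis
  qed
qed

lemma two_sided_ideal_smallest_ideal:
  assumes "F \<noteq> bot" and "mult_closed (filter_closure F)"
  shows "two_sided_ideal (filter_closure F) (smallest_ideal (filter_closure F))"
  unfolding smallest_ideal_eq[OF assms] using assms by (rule two_sided_ideal_recurrent)

section \<open>Collectionwise piecewise syndetic families\<close>

text \<open>Every point \<open>u p\<close> of the closed left ideal returns to \<open>p\<close> by
  some left factor \<open>v\<close>. As \<open>V\<close> is in \<open>v\<close>, some
  \<open>x\<close> in \<open>V\<close> has its quotient of the intersection in \<open>u p\<close>.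
  Compactness reduces this to a finite set of \<open>x\<close>, whose union of quotients is a member
  of \<open>beta_mult F p\<close>; unfolding the product shows that the corresponding
  \<open>y\<close> form a member of \<open>F\<close>.\<close>

lemma collectionwise_pws_if_members:
  assumes "F \<noteq> bot" and "mult_closed (filter_closure F)"
    and p: "p \<in> smallest_ideal (filter_closure F)" and sub: "\<A> \<subseteq> members p"
  shows "collectionwise_pws F \<A>"
proof -
  let ?T = "filter_closure F"
  have pT: "p \<in> ?T" and rec: "\<And>u. u \<in> ?T \<Longrightarrow> \<exists>v\<in>?T. p = beta_mult v (beta_mult u p)"
    using p unfolding smallest_ideal_eq[OF assms(1,2)] by auto
  have pb: "p \<in> beta" "p \<le> F" using pT by (auto simp: filter_closure_def)
  have Tp: "filter_closure (beta_mult F p) = (\<lambda>u. beta_mult u p) ` ?T"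
    using pb(1) by (rule filter_closure_mult)
  have ex: "\<exists>X. X \<in> Pf V \<and> {y. left_quot y (left_quot_set X (\<Inter>\<B>)) \<in> members p} \<in> members F"
    if V: "V \<in> members F" and B: "\<B> \<in> Pf \<A>" for V \<B>
  proof -
    have Bp: "\<Inter>\<B> \<in> members p" using B sub by (intro members_Inter) (auto simp: Pf_def)
    have "\<exists>x\<in>V. left_quot x (\<Inter>\<B>) \<in> members q" if "q \<in> filter_closure (beta_mult F p)" for q
    proof -
      have "q \<in> (\<lambda>u. beta_mult u p) ` ?T" using that Tp by simp
      then obtain u where u: "u \<in> ?T" "q = beta_mult u p" by blast
      then obtain v where v: "v \<in> ?T" "p = beta_mult v q" using rec by blast
      have "{x. left_quot x (\<Inter>\<B>) \<in> members q} \<in> members v"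
        using Bp v(2) members_beta_mult by metis
      moreover have "V \<in> members v" "v \<noteq> bot"
        using v(1) V members_antimono beta_neq_bot by (auto simp: filter_closure_def)
      ultimately have "V \<inter> {x. left_quot x (\<Inter>\<B>) \<in> members q} \<noteq> {}"
        by (metis empty_members members_Int)
      then show ?thesis by blast
    qed
    then obtain X where X: "finite X" "X \<subseteq> V"
        "(\<Union>x\<in>X. left_quot x (\<Inter>\<B>)) \<in> members (beta_mult F p)"
      using filter_closure_compact[of "beta_mult F p" V "\<lambda>x. left_quot x (\<Inter>\<B>)"] by metis
    have "X \<noteq> {}"
    proof
      assume "X = {}"
      moreover have "filter_closure (beta_mult F p) \<noteq> {}"
        using Tp pT by auto
      ultimately show False using X(3) by (simp add: empty_members filter_closure_empty_iff)
    qed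
    then show ?thesis
      using X by (auto simp: Pf_def left_quot_set_def members_beta_mult)
  qed
  define G where
    "G V \<B> = (SOME X. X \<in> Pf V \<and> {y. left_quot y (left_quot_set X (\<Inter>\<B>)) \<in> members p} \<in> members F)"
    for V \<B>
  \<comment> \<open>Collecting every \<open>y\<close> whose translate is in \<open>p\<close> keeps
    the whole family inside \<open>p\<close>, so the finite intersection property comes from
    \<open>p\<close> being proper.\<close>
  define \<delta> where "\<delta> V \<B> = {y. left_quot y (left_quot_set (G V \<B>) (\<Inter>\<B>)) \<in> members p}" for V \<B>
  have G: "G V \<B> \<in> Pf V" "\<delta> V \<B> \<in> members F" if "V \<in> members F" "\<B> \<in> Pf \<A>" for V \<B>
    using someI_ex[OF ex[OF that]] unfolding \<delta>_def G_def by auto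
  let ?C = "{left_quot y (left_quot_set (G V \<B>) (\<Inter>\<B>)) \<inter> V | V y \<B>.
             V \<in> members F \<and> \<B> \<in> Pf \<A> \<and> y \<in> \<delta> V \<B>}"
  have sub: "?C \<subseteq> members p"
    using members_antimono[OF pb(2)] by (auto simp: \<delta>_def members_Int)
  have "finite_intersection_property ?C"
    unfolding finite_intersection_property_def
  proof
    fix \<D> assume "\<D> \<in> Pf ?C"
    then have fin: "finite \<D>" and DC: "\<D> \<subseteq> ?C" unfolding Pf_def by blast+
    have "\<Inter>\<D> \<in> members p" by (rule members_Inter[OF fin subset_trans[OF DC sub]])
    then show "\<Inter>\<D> \<noteq> {}" using beta_neq_bot[OF pb(1)] empty_members by metis
  qed
  then show ?thesis
    unfolding collectionwise_pws_def using G by (intro exI[of _ G] exI[of _ \<delta>]) auto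
qed

text \<open>An ultrafilter \<open>q\<close> on the given family is corrected twice from the left: by
  an element of the smallest ideal, which turns the translates into the finite unions themselves,
  and by a \<open>w\<close> that selects the quotients from these unions.\<close>

lemma collectionwise_pws_obtains:
  assumes "F \<noteq> bot" and "mult_closed (filter_closure F)"
    and pws: "collectionwise_pws F \<A>" and "\<A> \<noteq> {}"
  obtains p where "p \<in> smallest_ideal (filter_closure F)" "\<A> \<subseteq> members p"
proof -
  let ?T = "filter_closure F" and ?K = "smallest_ideal (filter_closure F)"
  have K: "two_sided_ideal ?T ?K" using assms(1,2) by (rule two_sided_ideal_smallest_ideal)
  obtain G \<delta> where
    fns: "\<forall>V \<in> members F. G V \<in> Pf \<A> \<rightarrow> Pf V \<and> \<delta> V \<in> Pf \<A> \<rightarrow> members F" and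
    fip: "finite_intersection_property
          {left_quot y (left_quot_set (G V \<B>) (\<Inter>\<B>)) \<inter> V | V y \<B>.
             V \<in> members F \<and> \<B> \<in> Pf \<A> \<and> y \<in> \<delta> V \<B>}" (is "finite_intersection_property ?C")
    using pws unfolding collectionwise_pws_def by blast
  have G: "G V \<B> \<in> Pf V" and \<delta>: "\<delta> V \<B> \<in> members F"
    if "V \<in> members F" "\<B> \<in> Pf \<A>" for V \<B>
    using fns that by (auto simp: Pi_iff)
  have "(INF X\<in>?C. principal X) \<noteq> bot"
  proof
    assume "(INF X\<in>?C. principal X) = bot"
    then have "eventually (\<lambda>_. False) (INF X\<in>?C. principal X)" by simp
    then obtain \<D> where D: "finite \<D>" "\<D> \<subseteq> ?C" "eventually (\<lambda>_. False) (INF X\<in>\<D>. principal X)"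
      unfolding eventually_INF[of _ _ ?C] by auto
    have "(INF X\<in>\<D>. principal X) = principal (\<Inter>X\<in>\<D>. X)"
      using D(1) by (simp add: INF_principal_finite)
    then have "\<Inter>\<D> = {}" using D(3) by (auto simp: eventually_principal)
    moreover have "\<Inter>\<D> \<noteq> {}"
      using fip D(1,2) unfolding finite_intersection_property_def Pf_def by (cases "\<D> = {}") auto
    ultimately show False by blast
  qed
  then obtain q where "q \<in> filter_closure (INF X\<in>?C. principal X)" by (rule ultrafilter_exists)
  then have qb: "q \<in> beta" and qC: "?C \<subseteq> members q"
    by (auto simp: filter_closure_def le_INF_iff le_principal_members)
  have syn: "left_quot y (left_quot_set (G V \<B>) (\<Inter>\<B>)) \<in> members q" "V \<in> members q"
    if "V \<in> members F" "\<B> \<in> Pf \<A>" "y \<in> \<delta> V \<B>" for V \<B> y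
  proof -
    have "left_quot y (left_quot_set (G V \<B>) (\<Inter>\<B>)) \<inter> V \<in> members q"
      using qC that by blast
    then show "left_quot y (left_quot_set (G V \<B>) (\<Inter>\<B>)) \<in> members q" "V \<in> members q"
      by (auto simp: members_Int)
  qed
  \<comment> \<open>A single set already gives an index \<open>{A}\<close>. Since
    \<open>\<delta> V {A}\<close> is nonempty for each \<open>V\<close>, the ultrafilter
    \<open>q\<close> contains each \<open>V\<close> and therefore lies in \<open>?T\<close>.\<close>
  obtain A where "A \<in> \<A>" using \<open>\<A> \<noteq> {}\<close> by blast
  then have A: "{A} \<in> Pf \<A>" by (auto simp: Pf_def)
  have "V \<in> members q" if "V \<in> members F" for V
  proof -
    have "\<delta> V {A} \<noteq> {}" using \<delta>[OF that A] assms(1) empty_members by metis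
    then show ?thesis using syn(2)[OF that A] by blast
  qed
  then have qT: "q \<in> ?T" using qb by (auto simp: filter_closure_def members_le_iff)
  obtain k where k: "k \<in> ?K" "k \<in> ?T" using K unfolding two_sided_ideal_def by blast
  \<comment> \<open>The factor \<open>k\<close> moves \<open>q\<close> into the ideal. Each
    \<open>\<delta> V \<B>\<close> is in \<open>F\<close> and hence in \<open>k\<close>, so
    \<open>u\<close> contains each finite union of quotients and thus one of its terms.\<close>
  define u where "u = beta_mult k q"
  have u: "u \<in> ?K" using K k qT unfolding u_def two_sided_ideal_def by blast
  then have uT: "u \<in> ?T" using K unfolding two_sided_ideal_def by blast
  then have ub: "u \<in> beta" by (simp add: filter_closure_def)
  have hit: "\<exists>x\<in>V. left_quot x (\<Inter>\<B>) \<in> members u" if VB: "V \<in> members F" "\<B> \<in> Pf \<A>" for V \<B>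
  proof -
    have "\<delta> V \<B> \<in> members k" using \<delta>[OF VB] k(2) by (auto simp: filter_closure_def members_antimono)
    then have "{y. left_quot y (left_quot_set (G V \<B>) (\<Inter>\<B>)) \<in> members q} \<in> members k"
      by (rule members_mono) (use syn(1)[OF VB] in blast)
    then have "(\<Union>x\<in>G V \<B>. left_quot x (\<Inter>\<B>)) \<in> members u"
      unfolding u_def members_beta_mult left_quot_set_def .
    moreover have "finite (G V \<B>)" "G V \<B> \<subseteq> V" using G[OF VB] by (auto simp: Pf_def)
    ultimately obtain x where "x \<in> G V \<B>" "left_quot x (\<Inter>\<B>) \<in> members u"
      using beta_Union[OF ub] by metis
    then show ?thesis using \<open>G V \<B> \<subseteq> V\<close> by blast
  qed
  \<comment> \<open>An ultrafilter below this filter is the required \<open>w\<close>. That the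
    filter is proper asks for one \<open>x\<close> in a given member of \<open>F\<close> that serves
    finitely many sets of \<open>\<A>\<close>; \<open>hit\<close> for their intersection supplies
    it.\<close>
  have "inf F (right_preimage u \<A>) \<noteq> bot"
  proof
    assume "inf F (right_preimage u \<A>) = bot"
    then have "eventually (\<lambda>_. False) (inf F (right_preimage u \<A>))" by simp
    then obtain P Q where PQ: "eventually P F" "eventually Q (right_preimage u \<A>)" "\<And>x. P x \<Longrightarrow> Q x \<Longrightarrow> False"
      unfolding eventually_inf by auto
    obtain \<B> where B: "finite \<B>" "\<B> \<subseteq> \<A>"
        "eventually Q (INF A\<in>\<B>. principal {x. left_quot x A \<in> members u})"
      using PQ(2) unfolding right_preimage_def eventually_INF[of _ _ \<A>] by auto
    have "(INF A\<in>\<B>. principal {x. left_quot x A \<in> members u})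
        = principal (\<Inter>A\<in>\<B>. {x. left_quot x A \<in> members u})"
      using B(1) by (simp add: INF_principal_finite)
    then have Q: "Q x" if "\<And>A. A \<in> \<B> \<Longrightarrow> left_quot x A \<in> members u" for x
      using B(3) that by (simp add: eventually_principal)
    \<comment> \<open>The finite set \<open>\<B>\<close> may be empty, whereas \<open>hit\<close> is
      about nonempty subfamilies.\<close>
    have "insert A \<B> \<in> Pf \<A>" using B \<open>A \<in> \<A>\<close> by (auto simp: Pf_def)
    then obtain x where x: "P x" "left_quot x (\<Inter>(insert A \<B>)) \<in> members u"
      using hit[of "{x. P x}" "insert A \<B>"] PQ(1) by (auto simp: mem_members)
    have "left_quot x B \<in> members u" if "B \<in> \<B>" for B
      by (rule members_mono[OF x(2)]) (use that in \<open>auto simp: left_quot_def\<close>)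
    then show False using Q PQ(3) x(1) by blast
  qed
  then obtain w where "w \<in> filter_closure (inf F (right_preimage u \<A>))" by (rule ultrafilter_exists)
  then have w: "w \<in> ?T" "\<A> \<subseteq> members (beta_mult w u)"
    by (auto simp: filter_closure_def le_right_preimage)
  have "beta_mult w u \<in> ?K" using K w(1) u unfolding two_sided_ideal_def by blast
  then show ?thesis using that w(2) by blast
qed

section \<open>The equivalences\<close>

text \<open>The points of \<open>A\<close> that return to \<open>A\<close> along \<open>p\<close>; for an idempotent \<open>p\<close> this is the set
  usually denoted \<open>A\<^sup>\<star>\<close>.\<close>

definition star_set :: "'a::semigroup_mult filter \<Rightarrow> 'a set \<Rightarrow> 'a set" where
  "star_set p A = {x \<in> A. left_quot x A \<in> members p}"

lemma star_set_subset: "star_set p A \<subseteq> A"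
  by (auto simp: star_set_def)

lemma star_set_members:
  assumes "beta_mult p p = p" "A \<in> members p"
  shows "star_set p A \<in> members p"
proof -
  have "{x. left_quot x A \<in> members p} \<in> members p"
    using assms members_beta_mult by metis
  then have "A \<inter> {x. left_quot x A \<in> members p} \<in> members p"
    using assms(2) by (simp add: members_Int)
  then show ?thesis by (simp add: star_set_def Collect_conj_eq)
qed

text \<open>Taking returning points commutes with quotients, because the quotient by
  \<open>y\<close> of the quotient by \<open>x\<close> is the quotient by \<open>x * y\<close>. So
  \<open>star_set_members\<close> for \<open>left_quot x A\<close> suffices.\<close>

lemma left_quot_star_set:
  assumes "beta_mult p p = p" "x \<in> star_set p A"
  shows "left_quot x (star_set p A) \<in> members p"
proof -
  have "left_quot x A \<in> members p" using assms(2) by (simp add: star_set_def)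
  then have "star_set p (left_quot x A) \<in> members p" by (rule star_set_members[OF assms(1)])
  also have "star_set p (left_quot x A) = left_quot x (star_set p A)"
    unfolding star_set_def by (simp add: left_quot_left_quot) (simp add: left_quot_def)
  finally show ?thesis .
qed

section \<open>Ordered finite products and the FS-tree they define\<close>

definition index_product :: "'a::semigroup_mult list \<Rightarrow> nat set \<Rightarrow> 'a" where
  "index_product g H = list_product (map (\<lambda>t. g ! t) (sorted_list_of_set H))"

lemma list_product_append:
  "xs \<noteq> [] \<Longrightarrow> ys \<noteq> [] \<Longrightarrow> list_product (xs @ ys) = list_product xs * list_product ys"
proof (induction xs rule: list_product.induct)
  case (1 x)
  then show ?case by (cases ys) auto
qed (auto simp: mult.assoc)

lemma index_product_singleton: "index_product g {t} = g ! t"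
  by (simp add: index_product_def)

lemma index_product_Un:
  assumes "finite H" "finite J" "H \<noteq> {}" "J \<noteq> {}" and less: "\<And>s t. s \<in> H \<Longrightarrow> t \<in> J \<Longrightarrow> s < t"
  shows "index_product g (H \<union> J) = index_product g H * index_product g J"
proof -
  have "sorted_list_of_set (H \<union> J) = sorted_list_of_set H @ sorted_list_of_set J"
    by (rule sorted_distinct_set_unique)
      (use assms in \<open>auto simp: sorted_append dest: less intro: less_imp_le\<close>)
  then show ?thesis using assms(1-4) by (simp add: index_product_def list_product_append)
qed

lemma index_product_cong:
  assumes "\<And>t. t \<in> H \<Longrightarrow> g ! t = g' ! t" "finite H"
  shows "index_product g H = index_product g' H"
proof -
  have "map (\<lambda>t. g ! t) (sorted_list_of_set H) = map (\<lambda>t. g' ! t) (sorted_list_of_set H)"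
    using assms by (intro map_cong) auto
  then show ?thesis unfolding index_product_def by (rule arg_cong)
qed

text \<open>Only nonempty \<open>H\<close> are tested, since the product over the empty set is
  unspecified. The empty list therefore qualifies for every \<open>D\<close> and is the
  root.\<close>

definition product_tree :: "'a::semigroup_mult set \<Rightarrow> 'a list set" where
  "product_tree D = {f. \<forall>H. H \<noteq> {} \<longrightarrow> H \<subseteq> {..<length f} \<longrightarrow> index_product f H \<in> D}"

lemma index_product_prefix:
  assumes "prefix f g" "H \<subseteq> {..<length f}"
  shows "index_product g H = index_product f H"
proof (rule index_product_cong)
  show "finite H" using assms(2) finite_subset by blast
  show "g ! t = f ! t" if "t \<in> H" for t
    using assms that by (auto simp: prefix_def nth_append)
qed

text \<open>A nonempty index set of \<open>f @ [x]\<close> avoids the last index, consists of it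
  alone, or adds it to a nonempty set of earlier ones; the conjuncts are these three cases. Thus the
  branch at \<open>f\<close> is \<open>D\<close> cut by finitely many quotients of
  \<open>D\<close>.\<close>

lemma snoc_in_product_tree_iff:
  "f @ [x] \<in> product_tree D \<longleftrightarrow> f \<in> product_tree D \<and> x \<in> D \<and>
     (\<forall>H. H \<noteq> {} \<longrightarrow> H \<subseteq> {..<length f} \<longrightarrow> index_product f H * x \<in> D)"
  (is "?l \<longleftrightarrow> ?r")
proof
  let ?n = "length f"
  have last: "index_product (f @ [x]) {?n} = x" by (simp add: index_product_singleton)
  have init: "index_product (f @ [x]) H = index_product f H" if "H \<subseteq> {..<?n}" for H
    using that by (intro index_product_prefix) auto
  have both: "index_product (f @ [x]) (H \<union> {?n}) = index_product f H * x"
    if "H \<noteq> {}" "H \<subseteq> {..<?n}" for H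
    using that finite_subset[OF that(2)] init[OF that(2)] last
    by (subst index_product_Un) auto
  show ?r if l: ?l
  proof (intro conjI allI impI)
    have H: "index_product (f @ [x]) H \<in> D" if "H \<noteq> {}" "H \<subseteq> {..<Suc ?n}" for H
      using l that by (simp add: product_tree_def)
    have "index_product f H \<in> D" if "H \<noteq> {}" "H \<subseteq> {..<?n}" for H
      using H[of H] that init[of H] by (auto simp: lessThan_Suc)
    then show "f \<in> product_tree D" by (simp add: product_tree_def)
    show "x \<in> D" using H[of "{?n}"] last by simp
    show "index_product f H * x \<in> D" if "H \<noteq> {}" "H \<subseteq> {..<?n}" for H
      using H[of "H \<union> {?n}"] both[OF that] that by (auto simp: lessThan_Suc)
  qed
  show ?l if r: ?r
    unfolding product_tree_def
  proof (intro CollectI allI impI)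
    fix H assume H: "H \<noteq> {}" "H \<subseteq> {..<length (f @ [x])}"
    define J where "J = H - {?n}"
    have J: "J \<subseteq> {..<?n}" using H(2) by (auto simp: J_def less_Suc_eq)
    consider "H = J" "J \<noteq> {}" | "H = {?n}" | "H = J \<union> {?n}" "J \<noteq> {}"
      using H(1) by (auto simp: J_def)
    then show "index_product (f @ [x]) H \<in> D"
    proof cases
      case 1
      then show ?thesis using r J init[OF J] by (auto simp: product_tree_def)
    next
      case 2
      then show ?thesis using r last by simp
    next
      case 3
      then show ?thesis using r J both[OF _ J] by auto
    qed
  qed
qed

text \<open>If \<open>x\<close> is the product of \<open>g\<close> over indices \<open>H\<close>
  beyond \<open>f\<close>, then a product over indices \<open>J\<close> of \<open>f\<close>, times
  \<open>x\<close>, is the product of \<open>g\<close> over the union of \<open>J\<close> and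
  \<open>H\<close>, hence in \<open>D\<close>. So \<open>f\<close> can be extended by
  \<open>x\<close>.\<close>

lemma FS_tree_product_tree:
  assumes "D \<subseteq> A"
  shows "FS_tree_in A (product_tree D)"
  unfolding FS_tree_in_def tree_in_def index_product_def[symmetric]
proof (intro conjI ballI impI)
  have "[] \<in> product_tree D" by (simp add: product_tree_def)
  then show "product_tree D \<noteq> {}" by blast
  fix f assume f: "f \<in> product_tree D"
  show "set f \<subseteq> A"
  proof
    fix a assume "a \<in> set f"
    then obtain t where t: "t < length f" "f ! t = a" by (auto simp: in_set_conv_nth)
    then have "index_product f {t} \<in> D" using f by (simp add: product_tree_def)
    then show "a \<in> A" using t assms by (auto simp: index_product_singleton)
  qed
  show "butlast f \<in> product_tree D" if "length f > 0"
    using f that snoc_in_product_tree_iff[of "butlast f" "last f" D] by simp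
next
  fix f assume f: "f \<in> product_tree D"
  let ?n = "length f"
  show "branch (product_tree D) f = {index_product g H |g H. g \<in> product_tree D \<and> prefix f g \<and>
      H \<noteq> {} \<and> H \<subseteq> {..<length g} - {..<length f}}" (is "_ = ?R")
  proof (intro subset_antisym subsetI)
    fix x assume "x \<in> branch (product_tree D) f"
    then have "f @ [x] \<in> product_tree D" by (simp add: branch_def)
    moreover have "x = index_product (f @ [x]) {?n}" by (simp add: index_product_singleton)
    ultimately show "x \<in> ?R"
      by (intro CollectI exI[of _ "f @ [x]"] exI[of _ "{?n}"]) auto
  next
    fix x assume "x \<in> ?R"
    then obtain g H where g: "x = index_product g H" "g \<in> product_tree D" "prefix f g"
        and H: "H \<noteq> {}" "H \<subseteq> {..<length g} - {..<?n}" by blast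
    have D: "index_product g J \<in> D" if "J \<noteq> {}" "J \<subseteq> {..<length g}" for J
      using g(2) that by (simp add: product_tree_def)
    have len: "?n \<le> length g" using g(3) prefix_length_le by blast
    have "index_product f J * x \<in> D" if J: "J \<noteq> {}" "J \<subseteq> {..<?n}" for J
    proof -
      have "finite J" "finite H" using J H finite_subset by blast+
      then have "index_product g (J \<union> H) = index_product g J * index_product g H"
        using J H by (intro index_product_Un) force+
      moreover have "index_product g (J \<union> H) \<in> D"
        using J H len by (intro D) force+
      ultimately show ?thesis using index_product_prefix[OF g(3) J(2)] g(1) by simp
    qed
    moreover have "H \<subseteq> {..<length g}" using H(2) by blast
    then have "x \<in> D" using D[OF H(1)] g(1) by blast
    ultimately show "x \<in> branch (product_tree D) f"
      using f by (simp add: branch_def snoc_in_product_tree_iff)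
  qed
qed

text \<open>All products of \<open>f\<close> are in \<open>star_set p A\<close>, so the quotients of
  that set by them are in \<open>p\<close>; there are finitely many, and the branch is their
  intersection with \<open>star_set p A\<close>.\<close>

lemma branch_product_tree_members:
  assumes p: "beta_mult p p = p" and A: "A \<in> members p" and f: "f \<in> product_tree (star_set p A)"
  shows "branch (product_tree (star_set p A)) f \<in> members p"
proof -
  let ?D = "star_set p A"
  let ?\<H> = "{H. H \<noteq> {} \<and> H \<subseteq> {..<length f}}"
  have "finite ?\<H>" by (rule finite_subset[of _ "Pow {..<length f}"]) auto
  moreover have "left_quot (index_product f H) ?D \<in> members p" if "H \<in> ?\<H>" for H
    using f that by (intro left_quot_star_set[OF p]) (simp add: product_tree_def)
  ultimately have "\<Inter> ((\<lambda>H. left_quot (index_product f H) ?D) ` ?\<H>) \<in> members p"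
    by (intro members_Inter) auto
  then have "?D \<inter> \<Inter> ((\<lambda>H. left_quot (index_product f H) ?D) ` ?\<H>) \<in> members p"
    using star_set_members[OF p A] by (simp add: members_Int)
  then show ?thesis
    by (rule members_mono) (use f in \<open>auto simp: branch_def snoc_in_product_tree_iff left_quot_def\<close>)
qed

text \<open>An element \<open>y\<close> of the later branch is a product over indices beyond
  \<open>f @ [x]\<close>. Adding the index of \<open>x\<close> puts the factor \<open>x\<close> in
  front, so \<open>x * y\<close> is a product over indices beyond \<open>f\<close>.\<close>

lemma star_tree_if_FS_tree:
  assumes "FS_tree_in A \<T>"
  shows "star_tree_in A \<T>"
  unfolding star_tree_in_def
proof (intro conjI ballI subsetI)
  show "tree_in A \<T>" using assms by (simp add: FS_tree_in_def)
  fix f x y assume f: "f \<in> \<T>" and x: "x \<in> branch \<T> f" and y: "y \<in> branch \<T> (f @ [x])"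
  have B: "branch \<T> f = {index_product g H |g H. g \<in> \<T> \<and> prefix f g \<and>
      H \<noteq> {} \<and> H \<subseteq> {..<length g} - {..<length f}}" if "f \<in> \<T>" for f
    using assms that unfolding FS_tree_in_def index_product_def by blast
  have fx: "f @ [x] \<in> \<T>" using x by (simp add: branch_def)
  obtain g H where g: "y = index_product g H" "g \<in> \<T>" "prefix (f @ [x]) g"
      and H: "H \<noteq> {}" "H \<subseteq> {..<length g} - {..<length (f @ [x])}"
    using y unfolding B[OF fx] by blast
  let ?n = "length f"
  have len: "?n < length g" using prefix_length_le[OF g(3)] by simp
  have "g ! ?n = x" using g(3) by (auto simp: prefix_def)
  moreover have "finite H" using H(2) finite_subset by blast
  then have "index_product g ({?n} \<union> H) = index_product g {?n} * index_product g H"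
    using H by (intro index_product_Un) force+
  ultimately have "x * y = index_product g ({?n} \<union> H)"
    using g(1) by (simp add: index_product_singleton)
  moreover have "prefix f g" using g(3) append_prefixD by blast
  moreover have "{?n} \<union> H \<subseteq> {..<length g} - {..<?n}" using H(2) len by auto
  ultimately have "x * y \<in> branch \<T> f" unfolding B[OF f] using g(2) by blast
  then show "y \<in> left_quot x (branch \<T> f)" by (simp add: left_quot_def)
qed

lemma directed_witness_if_sequence_witness:
  assumes "sequence_witness F A C"
  shows "directed_witness F A {1..} C"
proof -
  have mono: "C n \<subseteq> C m" if "1 \<le> m" "m \<le> n" for m n
    using assms that unfolding sequence_witness_def monotone_on_def by auto
  have "downward_directed {1..} C"
    unfolding downward_directed_def
  proof (intro conjI ballI)
    fix m n :: nat assume "m \<in> {1..}" "n \<in> {1..}"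
    then show "\<exists>k\<in>{1..}. C k \<subseteq> C m \<inter> C n"
      using mono[of m "max m n"] mono[of n "max m n"] by (intro bexI[of _ "max m n"]) auto
  qed auto
  moreover have "\<exists>m\<in>{1..}. C m \<subseteq> left_quot x (C n)" if "n \<in> {1..}" "x \<in> C n" for n x
    using assms that unfolding sequence_witness_def atLeast_iff by blast
  ultimately show ?thesis
    using assms unfolding sequence_witness_def directed_witness_def by auto
qed

section \<open>The implications for a filter whose closure is a semigroup\<close>

context
  fixes F :: "'a::semigroup_mult filter"
  assumes nonbot: "F \<noteq> bot" and closed: "mult_closed (filter_closure F)"
begin

lemma FS_tree_if_filter_central:
  assumes "filter_central F A"
  shows "\<exists>\<T>. FS_tree_in A \<T> \<and> collectionwise_pws F (branch \<T> ` \<T>)"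
proof -
  obtain p where p: "p \<in> smallest_ideal (filter_closure F)" "beta_mult p p = p" "A \<in> members p"
    using assms unfolding filter_central_def by blast
  let ?\<T> = "product_tree (star_set p A)"
  have "branch ?\<T> ` ?\<T> \<subseteq> members p" using branch_product_tree_members[OF p(2,3)] by blast
  then have "collectionwise_pws F (branch ?\<T> ` ?\<T>)"
    by (rule collectionwise_pws_if_members[OF nonbot closed p(1)])
  then show ?thesis using FS_tree_product_tree[OF star_set_subset] by blast
qed

text \<open>The family consists of the intersections of finitely many branches, indexed by the sets
  of their nodes. It is collectionwise piecewise syndetic because one \<open>p\<close> in the
  smallest ideal contains all branches, hence all these intersections.\<close>

lemma directed_witness_if_star_tree:
  assumes tree: "star_tree_in A \<T>" and pws: "collectionwise_pws F (branch \<T> ` \<T>)"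
  shows "\<exists>(I :: 'a list set set) C. directed_witness F A I C"
proof -
  have tr: "\<T> \<noteq> {}" "\<And>f. f \<in> \<T> \<Longrightarrow> set f \<subseteq> A"
    and star: "\<And>f x y. f \<in> \<T> \<Longrightarrow> x \<in> branch \<T> f \<Longrightarrow> y \<in> branch \<T> (f @ [x]) \<Longrightarrow> x * y \<in> branch \<T> f"
    using tree unfolding star_tree_in_def tree_in_def left_quot_def by blast+
  obtain p where p: "p \<in> smallest_ideal (filter_closure F)" "branch \<T> ` \<T> \<subseteq> members p"
    using collectionwise_pws_obtains[OF nonbot closed pws] tr(1) by blast
  let ?C = "\<lambda>X. \<Inter>f\<in>X. branch \<T> f"
  have branch: "branch \<T> f \<subseteq> A" for f
    using tr(2)[of "f @ [x]" for x] by (auto simp: branch_def)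
  have "?C X \<subseteq> A" if X: "X \<in> Pf \<T>" for X
  proof -
    obtain f where "f \<in> X" using X by (auto simp: Pf_def)
    then show ?thesis using branch[of f] by blast
  qed
  moreover have "downward_directed (Pf \<T>) ?C"
    unfolding downward_directed_def
  proof (intro conjI ballI)
    obtain f where "f \<in> \<T>" using tr(1) by blast
    then have "{f} \<in> Pf \<T>" by (simp add: Pf_def)
    then show "Pf \<T> \<noteq> {}" by blast
    fix X Y assume "X \<in> Pf \<T>" "Y \<in> Pf \<T>"
    then show "\<exists>Z\<in>Pf \<T>. ?C Z \<subseteq> ?C X \<inter> ?C Y"
      by (intro bexI[of _ "X \<union> Y"]) (auto simp: Pf_def)
  qed
  moreover have "\<exists>Y\<in>Pf \<T>. ?C Y \<subseteq> left_quot x (?C X)" if "X \<in> Pf \<T>" "x \<in> ?C X" for X x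
  proof (rule bexI)
    \<comment> \<open>Each node is replaced by its successor along \<open>x\<close>; the star
      property, used node by node, then gives the inclusion into the quotient.\<close>
    show "(\<lambda>f. f @ [x]) ` X \<in> Pf \<T>" using that by (auto simp: Pf_def branch_def)
    show "?C ((\<lambda>f. f @ [x]) ` X) \<subseteq> left_quot x (?C X)"
      using that star by (auto simp: Pf_def left_quot_def)
  qed
  moreover have "collectionwise_pws F (?C ` Pf \<T>)"
  proof (rule collectionwise_pws_if_members[OF nonbot closed p(1)])
    have "\<Inter> (branch \<T> ` X) \<in> members p" if "X \<in> Pf \<T>" for X
      using that p(2) by (intro members_Inter) (auto simp: Pf_def)
    then show "?C ` Pf \<T> \<subseteq> members p" by blast
  qed
  ultimately have "directed_witness F A (Pf \<T>) ?C" by (simp add: directed_witness_def)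
  then show ?thesis by (intro exI)
qed

lemma filter_central_if_directed_witness:
  assumes "directed_witness F A I C"
  shows "filter_central F A"
proof -
  have CA: "\<And>i. i \<in> I \<Longrightarrow> C i \<subseteq> A" and "I \<noteq> {}" and pws: "collectionwise_pws F (C ` I)"
    and tail: "\<And>i x. i \<in> I \<Longrightarrow> x \<in> C i \<Longrightarrow> \<exists>j\<in>I. C j \<subseteq> left_quot x (C i)"
    using assms unfolding directed_witness_def downward_directed_def by auto
  let ?T = "filter_closure F" and ?K = "smallest_ideal (filter_closure F)"
  have K: "two_sided_ideal ?T ?K" using nonbot closed by (rule two_sided_ideal_smallest_ideal)
  obtain p where p: "p \<in> ?K" "C ` I \<subseteq> members p"
    using collectionwise_pws_obtains[OF nonbot closed pws] \<open>I \<noteq> {}\<close> by blast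
  then have pT: "p \<in> ?T" using K unfolding two_sided_ideal_def by blast
  then have pb: "p \<in> beta" by (simp add: filter_closure_def)
  have Tp: "filter_closure (beta_mult F p) = (\<lambda>u. beta_mult u p) ` ?T"
    using pb by (rule filter_closure_mult)
  let ?M = "inf (beta_mult F p) (INF i\<in>I. principal (C i))"
  have M: "r \<in> filter_closure ?M \<longleftrightarrow> r \<in> filter_closure (beta_mult F p) \<and> C ` I \<subseteq> members r" for r
    by (auto simp: filter_closure_def le_INF_iff le_principal_members)
  have sub: "filter_closure (beta_mult F p) \<subseteq> ?K"
    unfolding Tp using K p(1) unfolding two_sided_ideal_def by blast
  have "p \<in> filter_closure (beta_mult F p)"
  proof -
    \<comment> \<open>The recurrence with \<open>u = p\<close> reads \<open>p = (v p) p\<close>,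
      which places \<open>p\<close> in its left ideal even though there may be no identity.\<close>
    obtain v where "v \<in> ?T" "p = beta_mult v (beta_mult p p)"
      using p(1) pT unfolding smallest_ideal_eq[OF nonbot closed] by blast
    then have "p = beta_mult (beta_mult v p) p" "beta_mult v p \<in> ?T"
      using closed pT by (auto simp: beta_mult_assoc mult_closed_def)
    then show ?thesis unfolding Tp by blast
  qed
  then have "p \<in> filter_closure ?M" using p(2) M by blast
  then have "?M \<noteq> bot" using filter_closure_empty_iff by blast
  moreover have "mult_closed (filter_closure ?M)"
    unfolding mult_closed_def
  proof (intro ballI)
    fix r s assume "r \<in> filter_closure ?M" "s \<in> filter_closure ?M"
    then have r: "r \<in> filter_closure (beta_mult F p)" "C ` I \<subseteq> members r"
      and s: "s \<in> filter_closure (beta_mult F p)" "C ` I \<subseteq> members s" by (auto simp: M)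
    obtain u where u: "u \<in> ?T" "s = beta_mult u p" using s(1) unfolding Tp by blast
    have "r \<in> ?T" using r(1) sub K unfolding two_sided_ideal_def by blast
    then have "beta_mult r s \<in> filter_closure (beta_mult F p)"
      using u closed unfolding Tp by (auto simp: mult_closed_def beta_mult_assoc[symmetric])
    moreover have "C i \<in> members (beta_mult r s)" if "i \<in> I" for i
    proof -
      have "C i \<in> members r" using r(2) that by blast
      \<comment> \<open>For \<open>x\<close> in \<open>C i\<close>, \<open>tail\<close> gives some
        \<open>C j\<close> inside the quotient, and \<open>C j\<close> is in \<open>s\<close>. This
        is where condition (i) turns into closure under products.\<close>
      moreover have "C i \<subseteq> {x. left_quot x (C i) \<in> members s}"
        using tail[OF that] s(2) members_mono by blast
      ultimately show ?thesis unfolding members_beta_mult by (rule members_mono)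
    qed
    ultimately show "beta_mult r s \<in> filter_closure ?M" using M by blast
  qed
  ultimately obtain e where e: "e \<in> filter_closure ?M" "beta_mult e e = e"
    by (rule idempotent_exists)
  obtain i where i: "i \<in> I" using \<open>I \<noteq> {}\<close> by blast
  then have "C i \<in> members e" using e(1) M by blast
  then have "A \<in> members e" using CA[OF i] by (rule members_mono)
  moreover have "e \<in> ?K" using e(1) M sub by blast
  ultimately show ?thesis using e(2) unfolding filter_central_def by blast
qed

text \<open>The sets \<open>A\<^sup>\<star>\<close> and \<open>x\<^sup>-\<^sup>1 A\<^sup>\<star>\<close> with \<open>x \<in> A\<^sup>\<star>\<close> form a family of members of \<open>p\<close> that is closed
  under quotients by its points; the sequence consists of the initial intersections of an
  enumeration of this family.\<close>

lemma sequence_witness_if_filter_central: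
  assumes "filter_central F A" "countable (UNIV :: 'a set)"
  shows "\<exists>C. sequence_witness F A C"
proof -
  obtain p where p: "p \<in> smallest_ideal (filter_closure F)" "beta_mult p p = p" "A \<in> members p"
    using assms(1) unfolding filter_central_def by blast
  let ?D = "star_set p A"
  define \<E> where "\<E> = insert ?D ((\<lambda>x. left_quot x ?D) ` ?D)"
  have "countable ?D" by (rule countable_subset[OF subset_UNIV assms(2)])
  then have "countable \<E>" "\<E> \<noteq> {}" by (auto simp: \<E>_def)
  then have range: "range (from_nat_into \<E>) = \<E>" by (rule range_from_nat_into[rotated])
  \<comment> \<open>A quotient by \<open>x\<close> of the quotient by \<open>y\<close> is the
    quotient by \<open>y * x\<close>, and \<open>y * x\<close> lies in \<open>?D\<close> when
    \<open>x\<close> lies in the latter.\<close>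
  have quot: "left_quot x E \<in> \<E>" if "E \<in> \<E>" "x \<in> E" "x \<in> ?D" for E x
    using that by (auto simp: \<E>_def left_quot_left_quot) (auto simp: left_quot_def)
  have Ep: "\<E> \<subseteq> members p"
    using star_set_members[OF p(2,3)] left_quot_star_set[OF p(2)] by (auto simp: \<E>_def)
  \<comment> \<open>Intersecting with \<open>?D\<close> at every stage keeps each point of
    \<open>C n\<close> in \<open>?D\<close>, as \<open>quot\<close> requires, wherever
    \<open>?D\<close> occurs in the enumeration.\<close>
  define C where "C n = ?D \<inter> (\<Inter>i\<le>n. from_nat_into \<E> i)" for n
  have anti: "C n \<subseteq> C m" if "m \<le> n" for m n
    using that by (force simp: C_def)
  have tail: "\<exists>m\<ge>1. C m \<subseteq> left_quot x (C n)" if x: "x \<in> C n" for n x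
  proof -
    have "\<exists>m. C m \<subseteq> left_quot x E" if "E \<in> \<E>" "x \<in> E" for E
    proof -
      have "left_quot x E \<in> range (from_nat_into \<E>)" unfolding range using quot that x by (auto simp: C_def)
      then obtain m where "left_quot x E = from_nat_into \<E> m" by blast
      then show ?thesis by (intro exI[of _ m]) (auto simp: C_def)
    qed
    then obtain m where m: "\<And>E. E \<in> \<E> \<Longrightarrow> x \<in> E \<Longrightarrow> C (m E) \<subseteq> left_quot x E" by metis
    let ?\<X> = "insert ?D (from_nat_into \<E> ` {..n})"
    have X: "E \<in> \<E>" "x \<in> E" if "E \<in> ?\<X>" for E
      using that x range by (auto simp: C_def \<E>_def)
    \<comment> \<open>\<open>C n\<close> is a finite intersection, and \<open>?k\<close> is beyond
      the stages that handle each of its sets. The \<open>1\<close> is there because the sequence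
      starts at index 1.\<close>
    let ?k = "Max (insert 1 (m ` ?\<X>))"
    have "C ?k \<subseteq> left_quot x E" if "E \<in> ?\<X>" for E
    proof -
      have "m E \<le> ?k" using that by (intro Max_ge) auto
      then show ?thesis using anti m[OF X[OF that]] by blast
    qed
    then have "C ?k \<subseteq> left_quot x (C n)" by (auto simp: C_def left_quot_def)
    moreover have "1 \<le> ?k" by (rule Max_ge) auto
    ultimately show ?thesis by blast
  qed
  have "C n \<in> members p" for n
  proof -
    have "\<Inter> (from_nat_into \<E> ` {..n}) \<in> members p"
      using range Ep by (intro members_Inter) auto
    then show ?thesis using star_set_members[OF p(2,3)] by (simp add: C_def members_Int)
  qed
  then have "collectionwise_pws F (C ` {1..})"
    by (intro collectionwise_pws_if_members[OF nonbot closed p(1)]) auto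
  moreover have "C n \<subseteq> A" for n using star_set_subset by (auto simp: C_def)
  ultimately have "sequence_witness F A C"
    using anti tail unfolding sequence_witness_def monotone_on_def by auto
  then show ?thesis by blast
qed

end

theorem theorem5p7:
  fixes T :: "'a::semigroup_mult filter set" and \<F> :: "'a filter" and A :: "'a set"
  assumes "closed_subsemigroup T" and "filter_closure \<F> = T"
  shows
    "let a = filter_central \<F> A;
         b = (\<exists>\<T>. FS_tree_in A \<T> \<and> collectionwise_pws \<F> (branch \<T> ` \<T>));
         c = (\<exists>\<T>. star_tree_in A \<T> \<and> collectionwise_pws \<F> (branch \<T> ` \<T>));
         d = (\<exists>(I :: 'a set set) (C :: 'a set \<Rightarrow> 'a set). directed_witness \<F> A I C);
         e = (\<exists>C :: nat \<Rightarrow> 'a set. sequence_witness \<F> A C)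
     in (a \<longleftrightarrow> b) \<and> (b \<longleftrightarrow> c) \<and> (c \<longleftrightarrow> d) \<and> (e \<longrightarrow> a) \<and>
        (countable (UNIV :: 'a set) \<longrightarrow> (a \<longleftrightarrow> e))"
proof -
  have nonbot: "\<F> \<noteq> bot"
    using assms unfolding closed_subsemigroup_def by (metis filter_closure_empty_iff)
  have closed: "mult_closed (filter_closure \<F>)"
    using assms unfolding closed_subsemigroup_def mult_closed_def by simp
  \<comment> \<open>The tree construction indexes by sets of nodes;
    \<open>directed_witness_reindex\<close> passes to indices that are subsets of the
    semigroup.\<close>
  have ad: "\<exists>(I :: 'a set set) (C :: 'a set \<Rightarrow> 'a set). directed_witness \<F> A I C"
    if "filter_central \<F> A"
    using FS_tree_if_filter_central[OF nonbot closed that] star_tree_if_FS_tree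
      directed_witness_if_star_tree[OF nonbot closed] directed_witness_reindex by metis
  have ea: "filter_central \<F> A" if "sequence_witness \<F> A C" for C
    using directed_witness_if_sequence_witness[OF that]
      filter_central_if_directed_witness[OF nonbot closed] by blast
  have ca: "filter_central \<F> A" if "star_tree_in A \<T>" "collectionwise_pws \<F> (branch \<T> ` \<T>)" for \<T>
    using directed_witness_if_star_tree[OF nonbot closed that]
      filter_central_if_directed_witness[OF nonbot closed] by blast
  show ?thesis
    unfolding Let_def
    using FS_tree_if_filter_central[OF nonbot closed] ad ea ca star_tree_if_FS_tree
      filter_central_if_directed_witness[OF nonbot closed]
      sequence_witness_if_filter_central[OF nonbot closed] by meson
qed

end
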